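(* Let $\mathscr{G} = (\mathscr{V}, \mathscr{E})$ be a finite connected graph with $N$ vertices, let $\rho_z > 0$ for $z \in \mathscr{V}$, and consider the simple exclusion process on $\mathscr{G}$ with rates $(\rho_z)_{z \in \mathscr{V}}$. Let $D(z) = \deg(z)/\rho_z$ for $z \in \mathscr{V}$. For all $1 < K < N - 1$ and all $x, y \in \mathscr{V}$ with $D(x) < D(y)$, $$ \frac{D(x)}{D(y)} = \frac{p_1(x)}{p_1(y)} < \frac{p_K(x)}{p_K(y)} < \frac{p_{K+1}(x)}{p_{K+1}(y)} < \frac{p_N(x)}{p_N(y)} = 1. $$
   Context: Graphs are undirected, without loops or multiple edges; $\deg(x)$ is the degree of $x$. A configuration is a map $\eta : \mathscr{V} \to \{0,1\}$, where $\eta(x) = 1$ means that $x$ is occupied by a particle and $\eta(x) = 0$ that $x$ is empty. A configuration $\eta$ is identified with the subset $\{x \in \mathscr{V} : \eta(x) = 1\}$ of $\mathscr{V}$. For $x, y \in \mathscr{V}$, $\tau_{x,y}\eta$ is the configuration obtained from $\eta$ by exchanging the states at $x$ and $y$. The simple exclusion process with rates $(\rho_x)$ is the continuous-time Markov chain $(\eta_t)_{t\ge 0}$ on $\{0,1\}^{\mathscr{V}}$ that jumps from $\eta$ to $\xi \ne \eta$ at rate $q(\eta,\xi) = \rho_x/\deg(x)$ if $\xi = \tau_{x,y}\eta$ for some edge $(x,y) \in \mathscr{E}$ with $\eta(x) = 1$ (hence $\eta(y) = 0$), and at rate $q(\eta,\xi) = 0$ otherwise. In words, the particle at $x$, if there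 is one, chooses a neighbor of $x$ uniformly at random at rate $\rho_x$ and jumps there if and only if it is empty. For $0 < K \le N$ and $x \in \mathscr{V}$, $$ p_K(x) = \lim_{t \to \infty} P(x \in \eta_t \mid \operatorname{card}(\eta_0) = K); $$ these limits exist and depend on the initial configuration only through its number $K$ of particles. *)

theory Defs
  imports
    "HOL-Probability.Probability"
    "HOL-Combinatorics.Transposition"
    "Graph_Theory.Graph_Theory"
begin

section \<open>Continuous-time Markov chains on a finite state space\<close>

definition transition_function :: "'s set \<Rightarrow> (real \<Rightarrow> 's \<Rightarrow> 's \<Rightarrow> real) \<Rightarrow> bool" where
  "transition_function S P \<longleftrightarrow>
     (\<forall>t\<ge>0. \<forall>i\<in>S. (\<forall>j\<in>S. 0 \<le> P t i j) \<and> (\<Sum>j\<in>S. P t i j) = 1) \<and>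
     (\<forall>i\<in>S. \<forall>j\<in>S. P 0 i j = (if i = j then 1 else 0)) \<and>
     (\<forall>s\<ge>0. \<forall>t\<ge>0. \<forall>i\<in>S. \<forall>j\<in>S. P (s + t) i j = (\<Sum>k\<in>S. P s i k * P t k j))"

text \<open>
  The process \<open>X\<close> jumps from \<open>i\<close> to \<open>j \<noteq> i\<close> at rate \<open>q i j\<close>, that is, the transition probability
  over a time step \<open>h\<close> is \<open>q i j * h + o(h)\<close>. The diagonal of \<open>q\<close> is irrelevant. In the Markov
  property, \<open>F\<close> is a finite set of past times, \<open>s\<close> is the present time, and \<open>c\<close> is the
  observed trajectory on \<open>insert s F\<close>. The initial distribution is arbitrary.
\<close>

definition markov_chain_with_rates ::
    "'w measure \<Rightarrow> 's set \<Rightarrow> ('s \<Rightarrow> 's \<Rightarrow> real) \<Rightarrow> (real \<Rightarrow> 'w \<Rightarrow> 's) \<Rightarrow> bool" where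
  "markov_chain_with_rates M S q X \<longleftrightarrow>
     prob_space M \<and>
     (\<forall>t\<ge>0. X t \<in> measurable M (count_space S)) \<and>
     (\<forall>\<omega>\<in>space M. \<forall>t\<ge>0. \<forall>\<^sub>F s in at_right t. X s \<omega> = X t \<omega>) \<and>
     (\<exists>P. transition_function S P \<and>
        (\<forall>i\<in>S. \<forall>j\<in>S. i \<noteq> j \<longrightarrow> ((\<lambda>h. P h i j) has_real_derivative q i j) (at_right 0)) \<and>
        (\<forall>F s t c j. finite F \<longrightarrow> F \<subseteq> {0..s} \<longrightarrow> 0 \<le> s \<longrightarrow> 0 \<le> t \<longrightarrow> j \<in> S \<longrightarrow>
           \<P>(\<omega> in M. \<forall>u\<in>insert s F. X u \<omega> = c u) > 0 \<longrightarrow>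
           \<P>(\<omega> in M. X (s + t) \<omega> = j \<bar> \<forall>u\<in>insert s F. X u \<omega> = c u) = P t (c s) j))"


section \<open>The simple exclusion process\<close>

text \<open>
  A graph is a symmetric digraph without loops and parallel arcs (locale \<open>graph\<close>), so that the
  number of neighbours of a vertex is its out-degree. A configuration is the set of its occupied
  vertices.
\<close>

abbreviation deg :: "('v, 'e) pre_digraph \<Rightarrow> 'v \<Rightarrow> nat" where
  "deg G x \<equiv> out_degree G x"

definition swap_states :: "'v \<Rightarrow> 'v \<Rightarrow> 'v set \<Rightarrow> 'v set" where
  "swap_states x y \<eta> = {z. Transposition.transpose x y z \<in> \<eta>}"

text \<open>
  The sum has at most one term: if \<open>\<xi>\<close> arises from \<open>\<eta>\<close> by a jump from an occupied \<open>x\<close> to an empty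
  \<open>y\<close>, then \<open>\<eta> - \<xi> = {x}\<close> and \<open>\<xi> - \<eta> = {y}\<close>.
\<close>

definition exclusion_rate ::
    "('v, 'e) pre_digraph \<Rightarrow> ('v \<Rightarrow> real) \<Rightarrow> 'v set \<Rightarrow> 'v set \<Rightarrow> real" where
  "exclusion_rate G \<rho> \<eta> \<xi> =
     (\<Sum>(x, y) | (x, y) \<in> arcs_ends G \<and> x \<in> \<eta> \<and> y \<notin> \<eta> \<and> \<xi> = swap_states x y \<eta>.
        \<rho> x / real (deg G x))"

definition exclusion_process ::
    "('v, 'e) pre_digraph \<Rightarrow> ('v \<Rightarrow> real) \<Rightarrow> 'w measure \<Rightarrow> (real \<Rightarrow> 'w \<Rightarrow> 'v set) \<Rightarrow> bool" where
  "exclusion_process G \<rho> M \<eta> \<longleftrightarrow>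
     markov_chain_with_rates M (Pow (verts G)) (exclusion_rate G \<rho>) \<eta>"

definition limit_occupation ::
    "'w measure \<Rightarrow> (real \<Rightarrow> 'w \<Rightarrow> 'v set) \<Rightarrow> nat \<Rightarrow> 'v \<Rightarrow> real" where
  "limit_occupation M \<eta> k x =
     Lim at_top (\<lambda>t. \<P>(\<omega> in M. x \<in> \<eta> t \<omega> \<bar> card (\<eta> 0 \<omega>) = k))"

end

theory Submission
  imports Defs
begin

text \<open>
  The exclusion process conserves the number of particles and is reversible: on the configurations with
  \<open>k\<close> particles, detailed balance holds for the weights \<open>prod D \<xi>\<close>, where \<open>D z = deg z / \<rho> z\<close>
  (\<open>exclusion_detailed_balance\<close>). Since the graph is connected, these configurations communicate
  (\<open>exclusion_irreducible\<close>), and the chain converges to the normalised weights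
  (\<open>convergence_to_reversible_distribution\<close>). Hence \<open>p k x / p k y\<close> is a quotient of sums of products of
  \<open>D\<close> over the \<open>k\<close>-sets that contain \<open>x\<close> and over those that contain \<open>y\<close> (\<open>limit_occupation_exclusion\<close>).
  
  Let \<open>a = D x < b = D y\<close> and let \<open>E j\<close> be the \<open>j\<close>-th elementary symmetric sum of \<open>D\<close> over the remaining
  vertices. Distinguishing whether the other one of \<open>x\<close> and \<open>y\<close> is also occupied gives
  \<open>p k x / p k y = (a * E (k - 1) + a * b * E (k - 2)) / (b * E (k - 1) + a * b * E (k - 2))\<close>, with
  \<open>E (- 1) = 0\<close>. As long as \<open>E (k - 1) > 0\<close>, this is \<open>(a + a * b * r) / (b + a * b * r)\<close> for
  \<open>r = E (k - 2) / E (k - 1)\<close>. It increases strictly with \<open>r\<close> and stays below 1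
  (\<open>occupation_ratio_less\<close>), and \<open>r\<close> increases strictly with \<open>k\<close> because elementary symmetric sums of
  positive numbers are strictly log-concave (\<open>elem_sym_strict_log_concave\<close>). The two ends of the chain are
  \<open>r = 0\<close> for \<open>k = 1\<close> and \<open>E (k - 1) = 0\<close> for \<open>k = N\<close>, where the quotient is 1.
\<close>

section \<open>Elementary symmetric sums\<close>

definition elem_sym :: "('a \<Rightarrow> real) \<Rightarrow> 'a set \<Rightarrow> nat \<Rightarrow> real" where
  "elem_sym D A k = (\<Sum>B | B \<subseteq> A \<and> card B = k. \<Prod>z\<in>B. D z)"

lemma elem_sym_0 [simp]: "finite A \<Longrightarrow> elem_sym D A 0 = 1"
proof -
  assume A: "finite A"
  have "{B. B \<subseteq> A \<and> card B = 0} = {{}}"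
    using A by (auto dest: finite_subset)
  then show ?thesis by (simp add: elem_sym_def)
qed

lemma elem_sym_eq_0:
  assumes "finite A" "card A < k"
  shows "elem_sym D A k = 0"
proof -
  have "{B. B \<subseteq> A \<and> card B = k} = {}"
    using assms by (auto dest: card_mono)
  then show ?thesis unfolding elem_sym_def by (simp only: sum.empty)
qed

lemma elem_sym_pos:
  assumes "finite A" "k \<le> card A" "\<And>z. z \<in> A \<Longrightarrow> D z > 0"
  shows "elem_sym D A k > 0"
proof -
  obtain B where "B \<subseteq> A" "card B = k"
    using obtain_subset_with_card_n[OF assms(2)] by auto
  then have "{B. B \<subseteq> A \<and> card B = k} \<noteq> {}" by auto
  then show ?thesis
    unfolding elem_sym_def using assms(1,3)
    by (intro sum_pos prod_pos) auto
qed

text \<open>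
  Removing \<open>x\<close> from the set leaves an arbitrary \<open>k\<close>-subset of the other points. With \<open>D\<close> as weights, this
  sum is the unnormalised probability that \<open>x\<close> is occupied when there are \<open>Suc k\<close> particles.
\<close>

lemma sum_prod_subsets_containing:
  assumes "finite A" "x \<notin> A"
  shows "(\<Sum>B | B \<subseteq> insert x A \<and> card B = Suc k \<and> x \<in> B. \<Prod>z\<in>B. D z)
    = D x * elem_sym D A k"
proof -
  have "(\<Sum>B | B \<subseteq> insert x A \<and> card B = Suc k \<and> x \<in> B. \<Prod>z\<in>B. D z)
      = (\<Sum>B | B \<subseteq> A \<and> card B = k. D x * (\<Prod>z\<in>B. D z))"
  proof (rule sum.reindex_bij_witness[of _ "insert x" "\<lambda>B. B - {x}"])
    fix B assume B: "B \<in> {B. B \<subseteq> insert x A \<and> card B = Suc k \<and> x \<in> B}"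
    then have fin: "finite B" using assms(1) by (auto dest: finite_subset)
    show "insert x (B - {x}) = B" using B by auto
    show "B - {x} \<in> {B. B \<subseteq> A \<and> card B = k}" using B fin by auto
    show "D x * prod D (B - {x}) = prod D B"
      using B fin by (simp add: prod.remove[of B x])
  next
    fix B assume B: "B \<in> {B. B \<subseteq> A \<and> card B = k}"
    then have fin: "finite B" and x: "x \<notin> B" using assms by (auto dest: finite_subset)
    show "insert x B - {x} = B" using x by auto
    show "insert x B \<in> {B. B \<subseteq> insert x A \<and> card B = Suc k \<and> x \<in> B}"
      using B fin x by auto
  qed
  then show ?thesis by (simp add: elem_sym_def sum_distrib_left)
qed

lemma elem_sym_insert:
  assumes "finite A" "x \<notin> A"
  shows "elem_sym D (insert x A) (Suc k) = elem_sym D A (Suc k) + D x * elem_sym D A k"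
proof -
  have "elem_sym D (insert x A) (Suc k)
    = (\<Sum>B \<in> {B. B \<subseteq> A \<and> card B = Suc k} \<union> {B. B \<subseteq> insert x A \<and> card B = Suc k \<and> x \<in> B}. prod D B)"
    unfolding elem_sym_def by (rule sum.cong) auto
  also have "\<dots> = elem_sym D A (Suc k)
      + (\<Sum>B | B \<subseteq> insert x A \<and> card B = Suc k \<and> x \<in> B. prod D B)"
    unfolding elem_sym_def using assms by (intro sum.union_disjoint) auto
  finally show ?thesis
    using sum_prod_subsets_containing[OF assms] by simp
qed

text \<open>
  Newton's inequality in its weak form, without binomial factors. Adding a point of weight \<open>d\<close> turns
  \<open>E (k + 1)\<close> into \<open>E (k + 1) + d * E k\<close>, and the difference of the two sides becomes a quadratic polynomial in
  \<open>d\<close>. Its outer coefficients are nonnegative by log-concavity of \<open>E\<close>, and so is its middle one, by the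
  inequality between four consecutive terms that log-concavity implies when the two inner ones are positive.
\<close>

lemma elem_sym_strict_log_concave:
  assumes "finite A" "\<And>z. z \<in> A \<Longrightarrow> D z > 0" "Suc k \<le> card A"
  shows "elem_sym D A k * elem_sym D A (k + 2) < (elem_sym D A (k + 1))\<^sup>2"
  using assms
proof (induction A arbitrary: k rule: finite_induct)
  case (insert x A)
  let ?E = "elem_sym D A" and ?d = "D x"
  have pos: "k \<le> card A \<Longrightarrow> ?E k > 0" for k
    using insert.hyps insert.prems by (intro elem_sym_pos) auto
  have zero: "card A < k \<Longrightarrow> ?E k = 0" for k
    using insert.hyps by (intro elem_sym_eq_0) auto
  have nonneg: "?E k \<ge> 0" for k
    using pos[of k] zero[of k] by (cases "k \<le> card A") auto
  have d: "?d > 0" using insert.prems by auto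
  have concave: "?E k * ?E (k + 2) \<le> (?E (k + 1))\<^sup>2" for k
  proof (cases "Suc k \<le> card A")
    case True
    then show ?thesis using insert.IH[of k] insert.prems(1) by (intro less_imp_le) auto
  qed (simp add: zero)
  have k: "k \<le> card A" using insert by auto
  \<comment> \<open>For \<open>k = card A\<close> the old inequality degenerates to \<open>0 < 0\<close>; the strictness then comes from the
    coefficient \<open>(?E k)\<^sup>2\<close> of \<open>?d\<^sup>2\<close>.\<close>
  have top: "?E k * ?E (k + 2) < (?E (k + 1))\<^sup>2 \<or> (?E (k + 1) = 0 \<and> ?E (k + 2) = 0 \<and> ?E k > 0)"
    using insert pos[OF k] by (cases "Suc k \<le> card A") (auto simp: zero)
  show ?case
  proof (cases k)
    case 0
    have "?E 2 < (?E 1)\<^sup>2 \<or> (?E 1 = 0 \<and> ?E 2 = 0)"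
      using top insert.hyps by (auto simp: 0 numeral_2_eq_2)
    moreover have "?d * ?E 1 \<ge> 0" "?d * ?d > 0" using d nonneg by auto
    ultimately show ?thesis
      using insert.hyps elem_sym_insert[of A x D 0] elem_sym_insert[of A x D 1]
      by (auto simp: 0 power2_eq_square algebra_simps numeral_2_eq_2)
  next
    case (Suc m)
    \<comment> \<open>The product of two neighbouring log-concavity inequalities, cancelled by the two inner terms.\<close>
    have cross: "?E m * ?E (m + 3) \<le> ?E (m + 1) * ?E (m + 2)"
    proof (cases "m + 2 \<le> card A")
      case True
      then have p: "?E (m + 1) > 0" "?E (m + 2) > 0" by (auto intro!: pos)
      have "(?E m * ?E (m + 2)) * (?E (m + 1) * ?E (m + 3)) \<le> (?E (m + 1))\<^sup>2 * (?E (m + 2))\<^sup>2"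
        using concave[of m] concave[of "m + 1"] nonneg
        by (intro mult_mono) (auto simp: numeral_3_eq_3)
      then have "(?E m * ?E (m + 3)) * (?E (m + 1) * ?E (m + 2))
          \<le> (?E (m + 1) * ?E (m + 2)) * (?E (m + 1) * ?E (m + 2))"
        by (simp add: power2_eq_square mult_ac)
      then show ?thesis using p by (simp add: mult_le_cancel_right)
    qed (use zero[of "m+3"] nonneg in auto)
    have e: "elem_sym D (insert x A) k = ?E (m+1) + ?d * ?E m"
      "elem_sym D (insert x A) (k+1) = ?E (m+2) + ?d * ?E (m+1)"
      "elem_sym D (insert x A) (k+2) = ?E (m+3) + ?d * ?E (m+2)"
      using elem_sym_insert[OF insert.hyps(1,2), of D] by (auto simp: Suc numeral_eq_Suc)
    have c1: "?d * ?d * (?E m * ?E (m+2)) \<le> ?d * ?d * (?E (m+1))\<^sup>2"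
      using concave[of m] d by simp
    have c2: "?d * (?E m * ?E (m+3)) \<le> ?d * (?E (m+1) * ?E (m+2))"
      using cross d by simp
    have c3: "?E (m+1) * ?E (m+3) + ?d * ?d * (?E m * ?E (m+2))
        < (?E (m+2))\<^sup>2 + ?d * ?d * (?E (m+1))\<^sup>2"
      using top c1 d by (auto simp: Suc numeral_eq_Suc intro: add_less_le_mono)
    show ?thesis
      unfolding e using c2 c3 by (simp add: power2_eq_square algebra_simps)
  qed
qed simp

text \<open>
  For \<open>a < b\<close>, adding the same quantity \<open>a * b * r\<close> to the numerator and the denominator of \<open>a / b\<close> brings
  the quotient closer to 1, the more the larger \<open>r\<close> is.
\<close>

lemma occupation_ratio_less:
  fixes a b r s :: real
  assumes "0 < a" "a < b" "0 \<le> r" "r < s"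
  shows "(a + a * b * r) / (b + a * b * r) < (a + a * b * s) / (b + a * b * s)"
proof -
  have "a * b * (b - a) * r < a * b * (b - a) * s" using assms by simp
  moreover have "b + a * b * r > 0" "b + a * b * s > 0"
    using assms by (auto intro!: add_pos_nonneg)
  ultimately show ?thesis
    by (simp add: divide_simps) (simp add: algebra_simps)
qed


section \<open>Convergence of finite reversible Markov chains\<close>

text \<open>
  A function whose increments over a step \<open>h\<close> are \<open>o(h)\<close>, uniformly in the starting point, has derivative
  zero. The uniformity is what yields the left derivative as well: a step to the left from \<open>t\<close> is a step
  to the right from a point near \<open>t\<close>. This is how information about a transition function at time zero,
  the only place where its derivative is known, is transported to all times.
\<close>

lemma constant_if_increments_sublinear:
  fixes u g :: "real \<Rightarrow> real"
  assumes lim: "((\<lambda>h. g h / h) \<longlongrightarrow> 0) (at_right 0)"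
    and inc: "\<And>t h. 0 \<le> t \<Longrightarrow> 0 < h \<Longrightarrow> \<bar>u (t + h) - u t\<bar> \<le> g h"
    and t: "0 \<le> t"
  shows "u t = u 0"
proof -
  have "(u has_real_derivative 0) (at s within {0..})" if s: "s \<in> {0..}" for s
  proof -
    have "filterlim (\<lambda>y. \<bar>y - s\<bar>) (at_right 0) (at s within {0..})"
      unfolding filterlim_at
    proof
      have "((\<lambda>y. \<bar>y - s\<bar>) \<longlongrightarrow> \<bar>s - s\<bar>) (at s within {0..})" by (intro tendsto_intros)
      then show "((\<lambda>y. \<bar>y - s\<bar>) \<longlongrightarrow> 0) (at s within {0..})" by simp
      show "\<forall>\<^sub>F y in at s within {0..}. \<bar>y - s\<bar> \<in> {0<..} \<and> \<bar>y - s\<bar> \<noteq> 0"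
        by (auto simp: eventually_at_filter)
    qed
    from filterlim_compose[OF lim this]
    have "((\<lambda>y. g \<bar>y - s\<bar> / \<bar>y - s\<bar>) \<longlongrightarrow> 0) (at s within {0..})" .
    moreover have "\<forall>\<^sub>F y in at s within {0..}. norm ((u y - u s) / (y - s)) \<le> g \<bar>y - s\<bar> / \<bar>y - s\<bar>"
    proof -
      have "norm ((u y - u s) / (y - s)) \<le> g \<bar>y - s\<bar> / \<bar>y - s\<bar>" if y: "y \<ge> 0" "y \<noteq> s" for y
      proof -
        have "\<bar>u y - u s\<bar> \<le> g \<bar>y - s\<bar>"
          using inc[of s "y - s"] inc[of y "s - y"] s y by (cases "y > s") (auto simp: abs_minus_commute)
        then show ?thesis by (simp add: abs_divide divide_right_mono)
      qed
      then show ?thesis by (auto simp: eventually_at_filter)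
    qed
    ultimately have "((\<lambda>y. (u y - u s) / (y - s)) \<longlongrightarrow> 0) (at s within {0..})"
      by (rule Lim_null_comparison[rotated])
    then show ?thesis by (simp add: has_field_derivative_iff)
  qed
  then obtain c where "\<And>s. s \<in> {0..} \<Longrightarrow> u s = c"
    using has_field_derivative_zero_constant[of "{0..}" u] by auto
  then show ?thesis using t by simp
qed

locale finite_rate_chain =
  fixes S :: "'s set" and P :: "real \<Rightarrow> 's \<Rightarrow> 's \<Rightarrow> real" and q :: "'s \<Rightarrow> 's \<Rightarrow> real"
  assumes finite_S: "finite S"
    and transition: "transition_function S P"
    and rates: "\<And>i j. i \<in> S \<Longrightarrow> j \<in> S \<Longrightarrow> i \<noteq> j \<Longrightarrow>
      ((\<lambda>h. P h i j) has_real_derivative q i j) (at_right 0)"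
begin

lemma P_nonneg: "0 \<le> t \<Longrightarrow> i \<in> S \<Longrightarrow> j \<in> S \<Longrightarrow> 0 \<le> P t i j"
  and P_sum: "0 \<le> t \<Longrightarrow> i \<in> S \<Longrightarrow> (\<Sum>j\<in>S. P t i j) = 1"
  and P_0: "i \<in> S \<Longrightarrow> j \<in> S \<Longrightarrow> P 0 i j = (if i = j then 1 else 0)"
  and P_add: "0 \<le> s \<Longrightarrow> 0 \<le> t \<Longrightarrow> i \<in> S \<Longrightarrow> j \<in> S \<Longrightarrow>
    P (s + t) i j = (\<Sum>k\<in>S. P s i k * P t k j)"
  using transition unfolding transition_function_def by auto

lemma P_le_1: "0 \<le> t \<Longrightarrow> i \<in> S \<Longrightarrow> j \<in> S \<Longrightarrow> P t i j \<le> 1"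
  using member_le_sum[of j S "P t i"] finite_S P_nonneg P_sum by auto

text \<open>
  The diagonal makes the rows sum to zero, so that this is the derivative of \<open>P\<close> at zero on the diagonal, too.
\<close>

definition generator :: "'s \<Rightarrow> 's \<Rightarrow> real" where
  "generator i j = (if i = j then - (\<Sum>k\<in>S - {i}. q i k) else q i j)"

lemma P_deriv_0:
  assumes i: "i \<in> S" and j: "j \<in> S"
  shows "((\<lambda>h. P h i j) has_real_derivative generator i j) (at_right 0)"
proof (cases "i = j")
  case True
  have "((\<lambda>h. 1 - (\<Sum>k\<in>S - {i}. P h i k)) has_real_derivative 0 - (\<Sum>k\<in>S - {i}. q i k)) (at_right 0)"
    using i by (intro derivative_intros rates) auto
  moreover have "1 - (\<Sum>k\<in>S - {i}. P h i k) = P h i i" if "0 \<le> h" for h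
    using P_sum[OF that i] sum.remove[OF finite_S i, of "P h i"] by simp
  ultimately have "((\<lambda>h. P h i i) has_real_derivative 0 - (\<Sum>k\<in>S - {i}. q i k)) (at_right 0)"
    unfolding has_field_derivative_iff
    by (elim Lim_transform_eventually) (simp add: eventually_at_filter)
  then show ?thesis using True by (simp add: generator_def)
qed (use assms rates in \<open>auto simp: generator_def\<close>)

text \<open>
  By the Chapman-Kolmogorov equation, the increment of \<open>P t f\<close> over a step \<open>h\<close> is \<open>P t\<close> applied to
  \<open>P h f - f\<close>. The latter is \<open>o(h)\<close> if the generator annihilates \<open>f\<close>. Since the entries of
  \<open>P t\<close> lie between 0 and 1, its absolute values, summed over the states, bound the increment for all \<open>t\<close>.
\<close>

lemma harmonic_function_invariant:
  assumes harm: "\<And>i. i \<in> S \<Longrightarrow> (\<Sum>j\<in>S. generator i j * f j) = 0"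
    and i: "i \<in> S" and t: "0 \<le> t"
  shows "(\<Sum>j\<in>S. P t i j * f j) = f i"
proof -
  define g where "g h = (\<Sum>k\<in>S. \<bar>(\<Sum>j\<in>S. P h k j * f j) - f k\<bar>)" for h
  have P0f: "(\<Sum>j\<in>S. P 0 k j * f j) = f k" if "k \<in> S" for k
  proof -
    have "(\<Sum>j\<in>S. P 0 k j * f j) = (\<Sum>j\<in>S. if k = j then f j else 0)"
      using that by (intro sum.cong) (auto simp: P_0)
    then show ?thesis using that finite_S by simp
  qed
  have lim: "((\<lambda>h. ((\<Sum>j\<in>S. P h k j * f j) - f k) / h) \<longlongrightarrow> 0) (at_right 0)" if k: "k \<in> S" for k
  proof -
    have "((\<lambda>h. \<Sum>j\<in>S. P h k j * f j) has_real_derivative (\<Sum>j\<in>S. generator k j * f j)) (at_right 0)"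
      using k by (intro DERIV_sum DERIV_cmult_right P_deriv_0)
    then show ?thesis using k by (simp add: harm P0f has_field_derivative_iff)
  qed
  have "((\<lambda>h. \<Sum>k\<in>S. \<bar>((\<Sum>j\<in>S. P h k j * f j) - f k) / h\<bar>) \<longlongrightarrow> (\<Sum>k\<in>S. \<bar>0\<bar>)) (at_right 0)"
    by (intro tendsto_intros lim)
  moreover have "\<forall>\<^sub>F h in at_right 0. (\<Sum>k\<in>S. \<bar>((\<Sum>j\<in>S. P h k j * f j) - f k) / h\<bar>) = g h / h"
    by (auto simp: eventually_at_filter g_def sum_divide_distrib abs_divide)
  ultimately have "((\<lambda>h. g h / h) \<longlongrightarrow> 0) (at_right 0)"
    by (simp add: tendsto_cong)
  moreover have "\<bar>(\<Sum>j\<in>S. P (s + h) i j * f j) - (\<Sum>j\<in>S. P s i j * f j)\<bar> \<le> g h"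
    if s: "0 \<le> s" and h: "0 < h" for s h
  proof -
    have "(\<Sum>j\<in>S. P (s + h) i j * f j) = (\<Sum>j\<in>S. \<Sum>k\<in>S. P s i k * (P h k j * f j))"
      using s h i by (intro sum.cong) (auto simp: P_add sum_distrib_right mult.assoc)
    also have "\<dots> = (\<Sum>k\<in>S. P s i k * (\<Sum>j\<in>S. P h k j * f j))"
      by (subst sum.swap) (simp add: sum_distrib_left)
    finally have "(\<Sum>j\<in>S. P (s + h) i j * f j) - (\<Sum>j\<in>S. P s i j * f j)
        = (\<Sum>k\<in>S. P s i k * ((\<Sum>j\<in>S. P h k j * f j) - f k))"
      by (simp add: sum_subtractf right_diff_distrib)
    also have "\<bar>\<dots>\<bar> \<le> g h"
      unfolding g_def
    proof (rule order.trans[OF sum_abs], rule sum_mono)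
      fix k assume "k \<in> S"
      then show "\<bar>P s i k * ((\<Sum>j\<in>S. P h k j * f j) - f k)\<bar> \<le> \<bar>(\<Sum>j\<in>S. P h k j * f j) - f k\<bar>"
        using P_nonneg[OF s i] P_le_1[OF s i] by (simp add: abs_mult mult_left_le_one_le)
    qed
    finally show ?thesis .
  qed
  ultimately have "(\<Sum>j\<in>S. P t i j * f j) = (\<Sum>j\<in>S. P 0 i j * f j)"
    using t by (rule constant_if_increments_sublinear)
  then show ?thesis using P0f i by simp
qed

text \<open>
  The dual argument for weights on the states: now the short step comes first, and the increment of
  \<open>w P t\<close> over a step \<open>h\<close> is \<open>w P h - w\<close> followed by \<open>P t\<close>.
\<close>

lemma infinitesimally_invariant_weights_invariant:
  assumes inv: "\<And>j. j \<in> S \<Longrightarrow> (\<Sum>i\<in>S. w i * generator i j) = 0"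
    and j: "j \<in> S" and t: "0 \<le> t"
  shows "(\<Sum>i\<in>S. w i * P t i j) = w j"
proof -
  define g where "g h = (\<Sum>k\<in>S. \<bar>(\<Sum>i\<in>S. w i * P h i k) - w k\<bar>)" for h
  have wP0: "(\<Sum>i\<in>S. w i * P 0 i k) = w k" if "k \<in> S" for k
  proof -
    have "(\<Sum>i\<in>S. w i * P 0 i k) = (\<Sum>i\<in>S. if k = i then w i else 0)"
      using that by (intro sum.cong) (auto simp: P_0)
    then show ?thesis using that finite_S by simp
  qed
  have lim: "((\<lambda>h. ((\<Sum>i\<in>S. w i * P h i k) - w k) / h) \<longlongrightarrow> 0) (at_right 0)" if k: "k \<in> S" for k
  proof -
    have "((\<lambda>h. \<Sum>i\<in>S. w i * P h i k) has_real_derivative (\<Sum>i\<in>S. w i * generator i k)) (at_right 0)"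
      using k by (intro DERIV_sum DERIV_cmult P_deriv_0)
    then show ?thesis using k by (simp add: inv wP0 has_field_derivative_iff)
  qed
  have "((\<lambda>h. \<Sum>k\<in>S. \<bar>((\<Sum>i\<in>S. w i * P h i k) - w k) / h\<bar>) \<longlongrightarrow> (\<Sum>k\<in>S. \<bar>0\<bar>)) (at_right 0)"
    by (intro tendsto_intros lim)
  moreover have "\<forall>\<^sub>F h in at_right 0. (\<Sum>k\<in>S. \<bar>((\<Sum>i\<in>S. w i * P h i k) - w k) / h\<bar>) = g h / h"
    by (auto simp: eventually_at_filter g_def sum_divide_distrib abs_divide)
  ultimately have "((\<lambda>h. g h / h) \<longlongrightarrow> 0) (at_right 0)"
    by (simp add: tendsto_cong)
  moreover have "\<bar>(\<Sum>i\<in>S. w i * P (s + h) i j) - (\<Sum>i\<in>S. w i * P s i j)\<bar> \<le> g h"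
    if s: "0 \<le> s" and h: "0 < h" for s h
  proof -
    have "(\<Sum>i\<in>S. w i * P (s + h) i j) = (\<Sum>i\<in>S. \<Sum>k\<in>S. (w i * P h i k) * P s k j)"
      using s h j P_add[of h s] by (intro sum.cong) (auto simp: add.commute sum_distrib_left mult.assoc)
    also have "\<dots> = (\<Sum>k\<in>S. (\<Sum>i\<in>S. w i * P h i k) * P s k j)"
      by (subst sum.swap) (simp add: sum_distrib_right)
    finally have "(\<Sum>i\<in>S. w i * P (s + h) i j) - (\<Sum>i\<in>S. w i * P s i j)
        = (\<Sum>k\<in>S. ((\<Sum>i\<in>S. w i * P h i k) - w k) * P s k j)"
      by (simp add: sum_subtractf left_diff_distrib)
    also have "\<bar>\<dots>\<bar> \<le> g h"
      unfolding g_def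
    proof (rule order.trans[OF sum_abs], rule sum_mono)
      fix k assume "k \<in> S"
      then show "\<bar>((\<Sum>i\<in>S. w i * P h i k) - w k) * P s k j\<bar> \<le> \<bar>(\<Sum>i\<in>S. w i * P h i k) - w k\<bar>"
        using P_nonneg[OF s _ j] P_le_1[OF s _ j] by (simp add: abs_mult mult_left_le)
    qed
    finally show ?thesis .
  qed
  ultimately have "(\<Sum>i\<in>S. w i * P t i j) = (\<Sum>i\<in>S. w i * P 0 i j)"
    using t by (rule constant_if_increments_sublinear)
  then show ?thesis using wP0 j by simp
qed

lemma detailed_balance_invariant:
  assumes bal: "\<And>i j. i \<in> S \<Longrightarrow> j \<in> S \<Longrightarrow> w i * q i j = w j * q j i"
    and j: "j \<in> S" and t: "0 \<le> t"
  shows "(\<Sum>i\<in>S. w i * P t i j) = w j"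
proof (rule infinitesimally_invariant_weights_invariant[OF _ j t])
  fix j assume j: "j \<in> S"
  have "(\<Sum>i\<in>S - {j}. w i * generator i j) = (\<Sum>i\<in>S - {j}. w j * q j i)"
    using j by (intro sum.cong) (auto simp: generator_def bal)
  then show "(\<Sum>i\<in>S. w i * generator i j) = 0"
    using sum.remove[OF finite_S j, of "\<lambda>i. w i * generator i j"]
    by (simp add: generator_def sum_distrib_left)
qed

text \<open>
  If no jump enters or leaves \<open>C\<close>, the indicator function of its complement is annihilated by the generator.
\<close>

lemma P_outside_closed_class:
  assumes C: "C \<subseteq> S"
    and closed: "\<And>i j. i \<in> S \<Longrightarrow> j \<in> S \<Longrightarrow> (i \<in> C) \<noteq> (j \<in> C) \<Longrightarrow> q i j = 0"
    and i: "i \<in> C" and j: "j \<in> S - C" and t: "0 \<le> t"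
  shows "P t i j = 0"
proof -
  let ?f = "\<lambda>j. if j \<in> C then 0 else 1 :: real"
  have "(\<Sum>k\<in>S. P t i k * ?f k) = ?f i"
  proof (rule harmonic_function_invariant)
    fix k assume k: "k \<in> S"
    have "(\<Sum>l\<in>S - {k}. generator k l) = (\<Sum>l\<in>S - {k}. q k l)"
      by (intro sum.cong) (auto simp: generator_def)
    then have q0: "generator k k = - (\<Sum>l\<in>S - {k}. generator k l)"
      by (simp only: generator_def if_True simp_thms)
    have "(\<Sum>l\<in>S - {k}. generator k l * ?f l) = (\<Sum>l\<in>S - {k}. generator k l * ?f k)"
      using k closed by (intro sum.cong) (auto simp: generator_def)
    then show "(\<Sum>l\<in>S. generator k l * ?f l) = 0"
      using sum.remove[OF finite_S k, of "\<lambda>l. generator k l * ?f l"] q0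
      by (simp flip: sum_distrib_right)
  qed (use i C t in auto)
  then have "(\<Sum>k\<in>S. P t i k * ?f k) = 0" using i by simp
  then have "\<forall>k\<in>S. P t i k * ?f k = 0"
    using i C t finite_S by (subst (asm) sum_nonneg_eq_0_iff) (auto intro!: mult_nonneg_nonneg P_nonneg)
  then show ?thesis using j by force
qed

lemma closed_class_chain:
  assumes C: "C \<subseteq> S"
    and closed: "\<And>i j. i \<in> S \<Longrightarrow> j \<in> S \<Longrightarrow> (i \<in> C) \<noteq> (j \<in> C) \<Longrightarrow> q i j = 0"
  shows "finite_rate_chain C P q"
proof
  show "finite C" using C finite_S by (rule finite_subset)
  have drop: "(\<Sum>k\<in>S. P t i k * f k) = (\<Sum>k\<in>C. P t i k * f k)"
    if "i \<in> C" "0 \<le> t" for t :: real and i f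
    using that P_outside_closed_class[OF C closed]
    by (intro sum.mono_neutral_right) (auto simp: finite_S C)
  show "transition_function C P"
    unfolding transition_function_def
  proof (intro conjI allI ballI impI)
    fix t :: real and i assume "0 \<le> t" "i \<in> C"
    then show "sum (P t i) C = 1"
      using drop[of i t "\<lambda>_. 1"] P_sum[of t i] C by auto
  next
    fix s t :: real and i j assume "0 \<le> s" "0 \<le> t" "i \<in> C" "j \<in> C"
    then show "P (s + t) i j = (\<Sum>k\<in>C. P s i k * P t k j)"
      using drop[of i s "\<lambda>k. P t k j"] P_add[of s t i j] C by auto
  next
    fix t :: real and i j assume "0 \<le> t" "i \<in> C" "j \<in> C"
    then show "0 \<le> P t i j" using C by (intro P_nonneg) auto
  next
    fix i j assume "i \<in> C" "j \<in> C"
    then show "P 0 i j = (if i = j then 1 else 0)" using C by (intro P_0) auto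
  qed
  show "((\<lambda>h. P h i j) has_real_derivative q i j) (at_right 0)"
    if "i \<in> C" "j \<in> C" "i \<noteq> j" for i j
    using that C by (intro rates) auto
qed

lemma P_mult_le:
  assumes "0 \<le> s" "0 \<le> t" "i \<in> S" "k \<in> S" "j \<in> S"
  shows "P s i k * P t k j \<le> P (s + t) i j"
  using assms P_add[of s t i j]
    member_le_sum[of k S "\<lambda>k. P s i k * P t k j"] finite_S P_nonneg
  by auto

text \<open>
  Staying at \<open>i\<close> has positive probability over short times by continuity at zero, and over long times
  by dividing them into short steps.
\<close>

lemma P_diag_pos:
  assumes i: "i \<in> S" and t: "0 \<le> t"
  shows "P t i i > 0"
proof (cases "t = 0")
  case False
  then have t: "t > 0" using t by simp
  have "((\<lambda>h. P h i i) \<longlongrightarrow> P 0 i i) (at_right 0)"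
    using DERIV_continuous[OF P_deriv_0[OF i i]] by (simp add: continuous_within)
  then have "\<forall>\<^sub>F h in at_right 0. P h i i > 0"
    using i by (intro order_tendstoD(1)[of _ "P 0 i i"]) (auto simp: P_0)
  then obtain b where b: "b > 0" "\<And>h. 0 < h \<Longrightarrow> h < b \<Longrightarrow> P h i i > 0"
    unfolding eventually_at_right_field by auto
  obtain n :: nat where n: "t / b < real n" using reals_Archimedean2 by blast
  moreover have "0 < t / b" using t b by simp
  ultimately have n0: "0 < real n" by linarith
  then have "t / real n < b" "0 < t / real n"
    using n b t by (auto simp: field_simps)
  then have pos: "P (t / n) i i > 0" using b by auto
  have "P (real m * (t / n)) i i > 0" for m :: nat
  proof (induction m)
    case (Suc m)
    have "0 < P (t / n) i i * P (real m * (t / n)) i i" using Suc pos by simp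
    also have "\<dots> \<le> P (t / n + real m * (t / n)) i i"
      using t n0 i by (intro P_mult_le) auto
    also have "t / n + real m * (t / n) = real (Suc m) * (t / n)"
      by (simp only: of_nat_Suc distrib_right mult_1_left)
    finally show ?case .
  qed (simp add: P_0 i)
  from this[of n] show ?thesis using n0 by simp
qed (simp add: P_0 i)

lemma P_pos_if_rate_pos:
  assumes i: "i \<in> S" and j: "j \<in> S" and ne: "i \<noteq> j" and q: "q i j > 0" and t: "0 < t"
  shows "P t i j > 0"
proof -
  have "((\<lambda>h. P h i j / h) \<longlongrightarrow> q i j) (at_right 0)"
    using rates[OF i j ne] ne i j by (simp add: has_field_derivative_iff P_0)
  then have "\<forall>\<^sub>F h in at_right 0. P h i j / h > 0"
    using q by (rule order_tendstoD(1))
  then obtain b where b: "b > 0" "\<And>h. 0 < h \<Longrightarrow> h < b \<Longrightarrow> P h i j / h > 0"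
    unfolding eventually_at_right_field by auto
  \<comment> \<open>Jump within a time in which the rate controls the probability, then stay at \<open>j\<close>.\<close>
  define h where "h = min (b / 2) t"
  have h: "0 < h" "h < b" "h \<le> t" using b(1) t by (auto simp: h_def)
  then have "P h i j > 0" using b(2)[of h] by (simp add: zero_less_divide_iff)
  then have "0 < P h i j * P (t - h) j j" using P_diag_pos[OF j] h by simp
  also have "\<dots> \<le> P (h + (t - h)) i j" using h i j by (intro P_mult_le) auto
  finally show ?thesis by simp
qed

lemma P_pos_if_reachable:
  assumes reach: "(i, j) \<in> {(i, j). i \<in> S \<and> j \<in> S \<and> i \<noteq> j \<and> q i j > 0}\<^sup>*"
    and i: "i \<in> S" and t: "0 < t"
  shows "P t i j > 0 \<and> j \<in> S"
  using reach t
proof (induction arbitrary: t rule: rtrancl_induct)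
  case base
  then show ?case using P_diag_pos[OF i] i by simp
next
  case (step k j)
  have "0 < P (t / 2) i k * P (t / 2) k j"
    using step P_pos_if_rate_pos[of k j "t / 2"] by (auto intro!: mult_pos_pos)
  also have "\<dots> \<le> P (t / 2 + t / 2) i j"
    using step i by (intro P_mult_le) auto
  finally show ?case using step by auto
qed

text \<open>
  Irreducibility makes all entries of \<open>P 1\<close> at least some \<open>\<epsilon> > 0\<close> (Doeblin's condition). The signed
  weights \<open>P t i - w\<close> have total mass zero, so they are propagated in the same way by \<open>P 1\<close> and by
  \<open>P 1\<close> with \<open>\<epsilon>\<close> subtracted from each entry. The rows of the latter are nonnegative with sum
  \<open>\<theta> < 1\<close>, and therefore the l1 distance between \<open>P t i\<close> and the invariant weights \<open>w\<close> shrinks at least by the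
  factor \<open>\<theta>\<close> in each unit of time.
\<close>

theorem convergence_to_reversible_distribution:
  assumes irreducible: "\<And>i j. i \<in> S \<Longrightarrow> j \<in> S \<Longrightarrow>
      (i, j) \<in> {(i, j). i \<in> S \<and> j \<in> S \<and> i \<noteq> j \<and> q i j > 0}\<^sup>*"
    and bal: "\<And>i j. i \<in> S \<Longrightarrow> j \<in> S \<Longrightarrow> w i * q i j = w j * q j i"
    and sum_w: "(\<Sum>i\<in>S. w i) = 1"
    and i: "i \<in> S" and j: "j \<in> S"
  shows "((\<lambda>t. P t i j) \<longlongrightarrow> w j) at_top"
proof -
  define \<epsilon> where "\<epsilon> = Min ((\<lambda>(k, l). P 1 k l) ` (S \<times> S))"
  have \<epsilon>_le: "\<epsilon> \<le> P 1 k l" if "k \<in> S" "l \<in> S" for k l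
    unfolding \<epsilon>_def using finite_S that by (intro Min_le) auto
  have "\<epsilon> \<in> (\<lambda>(k, l). P 1 k l) ` (S \<times> S)"
    unfolding \<epsilon>_def using finite_S i by (intro Min_in) auto
  then have \<epsilon>0: "\<epsilon> > 0" using P_pos_if_reachable[OF irreducible] by auto
  define \<theta> where "\<theta> = 1 - real (card S) * \<epsilon>"
  have "card S > 0" using i finite_S by (auto simp: card_gt_0_iff)
  then have \<theta>1: "\<theta> < 1" using \<epsilon>0 by (simp add: \<theta>_def)
  have row: "(\<Sum>l\<in>S. P 1 k l - \<epsilon>) = \<theta>" if "k \<in> S" for k
    using that P_sum[of 1 k] by (simp add: sum_subtractf \<theta>_def)
  have \<theta>0: "\<theta> \<ge> 0"
    using row[OF i] sum_nonneg[of S "\<lambda>l. P 1 i l - \<epsilon>"] \<epsilon>_le i by auto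
  define d where "d t = (\<Sum>l\<in>S. \<bar>P t i l - w l\<bar>)" for t
  have contract: "d (t + 1) \<le> \<theta> * d t" if t: "0 \<le> t" for t
  proof -
    have "P (t + 1) i l - w l = (\<Sum>k\<in>S. (P t i k - w k) * (P 1 k l - \<epsilon>))" if l: "l \<in> S" for l
    proof -
      have "(\<Sum>k\<in>S. (P t i k - w k) * \<epsilon>) = 0"
        using P_sum[OF t i] sum_w by (simp add: sum_subtractf flip: sum_distrib_right)
      moreover have "(\<Sum>k\<in>S. (P t i k - w k) * (P 1 k l - \<epsilon>))
          = (\<Sum>k\<in>S. P t i k * P 1 k l) - (\<Sum>k\<in>S. w k * P 1 k l) - (\<Sum>k\<in>S. (P t i k - w k) * \<epsilon>)"
        unfolding sum_subtractf[symmetric] by (intro sum.cong) (auto simp: algebra_simps)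
      ultimately show ?thesis
        using P_add[of t 1 i l] detailed_balance_invariant[OF bal l, of 1] t i l by simp
    qed
    then have "d (t + 1) = (\<Sum>l\<in>S. \<bar>\<Sum>k\<in>S. (P t i k - w k) * (P 1 k l - \<epsilon>)\<bar>)"
      by (simp add: d_def)
    also have "\<dots> \<le> (\<Sum>l\<in>S. \<Sum>k\<in>S. \<bar>P t i k - w k\<bar> * (P 1 k l - \<epsilon>))"
      using \<epsilon>_le by (intro sum_mono order.trans[OF sum_abs]) (auto simp: abs_mult)
    also have "\<dots> = (\<Sum>k\<in>S. \<bar>P t i k - w k\<bar> * (\<Sum>l\<in>S. P 1 k l - \<epsilon>))"
      by (subst sum.swap) (simp add: sum_distrib_left)
    also have "\<dots> = \<theta> * d t"
      using row by (simp add: d_def mult.commute flip: sum_distrib_left)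
    finally show ?thesis .
  qed
  define B where "B = (\<Sum>l\<in>S. 1 + \<bar>w l\<bar>)"
  have bound: "d t \<le> B" if "0 \<le> t" for t
    unfolding d_def B_def
  proof (rule sum_mono)
    fix l assume "l \<in> S"
    then show "\<bar>P t i l - w l\<bar> \<le> 1 + \<bar>w l\<bar>"
      using P_nonneg[OF that i] P_le_1[OF that i] by (smt (verit))
  qed
  have geometric: "d (t + real n) \<le> \<theta> ^ n * B" if t: "0 \<le> t" for t n
  proof (induction n)
    case (Suc n)
    have "d (t + real (Suc n)) \<le> \<theta> * d (t + real n)"
      using contract[of "t + real n"] t by (simp add: algebra_simps)
    also have "\<dots> \<le> \<theta> * (\<theta> ^ n * B)" using Suc \<theta>0 by (intro mult_left_mono) auto
    finally show ?case by (simp add: mult.assoc)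
  qed (use bound t in simp)
  have "((\<lambda>n. \<theta> ^ n * B) \<longlongrightarrow> 0 * B) sequentially"
    using \<theta>0 \<theta>1 by (intro tendsto_intros LIMSEQ_realpow_zero) auto
  then have "((\<lambda>n. \<theta> ^ n * B) \<longlongrightarrow> 0) sequentially" by simp
  moreover have "filterlim (\<lambda>t :: real. nat \<lfloor>t\<rfloor>) sequentially at_top"
    by (intro filterlim_compose[OF filterlim_nat_sequentially filterlim_floor_sequentially])
  ultimately have lim: "((\<lambda>t :: real. \<theta> ^ nat \<lfloor>t\<rfloor> * B) \<longlongrightarrow> 0) at_top"
    by (rule filterlim_compose)
  have distance_le: "norm (P t i j - w j) \<le> \<theta> ^ nat \<lfloor>t\<rfloor> * B" if t: "0 \<le> t" for t
  proof -
    have "norm (P t i j - w j) \<le> d t"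
      unfolding d_def using member_le_sum[of j S "\<lambda>l. \<bar>P t i l - w l\<bar>"] j finite_S by auto
    also have "d t = d (frac t + real (nat \<lfloor>t\<rfloor>))" using t by (simp add: frac_def)
    also have "\<dots> \<le> \<theta> ^ nat \<lfloor>t\<rfloor> * B" by (rule geometric) simp
    finally show ?thesis .
  qed
  have "\<forall>\<^sub>F t in at_top. norm (P t i j - w j) \<le> \<theta> ^ nat \<lfloor>t\<rfloor> * B"
    using eventually_ge_at_top[of "0 :: real"] by eventually_elim (rule distance_le)
  then have "((\<lambda>t. P t i j - w j) \<longlongrightarrow> 0) at_top" using lim by (rule Lim_null_comparison)
  then show ?thesis by (rule LIM_zero_cancel)
qed

end

text \<open>
  The initial state need not lie in the closed class \<open>C\<close> almost surely. Conditioned on this event, the law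
  at time \<open>t\<close> is a mixture of the rows of \<open>P t\<close> that start in \<open>C\<close>. All of them have the same limit, so
  the mixing weights cancel.
\<close>

lemma markov_chain_conditional_limit:
  assumes chain: "markov_chain_with_rates M S q X"
    and finite_S: "finite S" and C: "C \<subseteq> S"
    and closed: "\<And>i j. i \<in> S \<Longrightarrow> j \<in> S \<Longrightarrow> (i \<in> C) \<noteq> (j \<in> C) \<Longrightarrow> q i j = 0"
    and irreducible: "\<And>i j. i \<in> C \<Longrightarrow> j \<in> C \<Longrightarrow>
      (i, j) \<in> {(i, j). i \<in> C \<and> j \<in> C \<and> i \<noteq> j \<and> q i j > 0}\<^sup>*"
    and bal: "\<And>i j. i \<in> C \<Longrightarrow> j \<in> C \<Longrightarrow> w i * q i j = w j * q j i"
    and sum_w: "(\<Sum>i\<in>C. w i) = 1"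
    and start: "\<P>(\<omega> in M. X 0 \<omega> \<in> C) > 0"
  shows "((\<lambda>t. \<P>(\<omega> in M. X t \<omega> \<in> B \<bar> X 0 \<omega> \<in> C)) \<longlongrightarrow> (\<Sum>j\<in>B \<inter> C. w j)) at_top"
proof -
  interpret prob_space M using chain by (simp add: markov_chain_with_rates_def)
  obtain P where P: "transition_function S P"
      "\<forall>i\<in>S. \<forall>j\<in>S. i \<noteq> j \<longrightarrow> ((\<lambda>h. P h i j) has_real_derivative q i j) (at_right 0)"
    and markov: "\<forall>F s t c j. finite F \<longrightarrow> F \<subseteq> {0..s} \<longrightarrow> 0 \<le> s \<longrightarrow> 0 \<le> t \<longrightarrow> j \<in> S \<longrightarrow>
           \<P>(\<omega> in M. \<forall>u\<in>insert s F. X u \<omega> = c u) > 0 \<longrightarrow>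
           \<P>(\<omega> in M. X (s + t) \<omega> = j \<bar> \<forall>u\<in>insert s F. X u \<omega> = c u) = P t (c s) j"
    using chain unfolding markov_chain_with_rates_def by (elim conjE exE) (rule that)
  have meas: "X t \<in> measurable M (count_space S)" if "0 \<le> t" for t
    using chain that by (simp add: markov_chain_with_rates_def)
  interpret S: finite_rate_chain S P q
    using finite_S P(1) P(2)[rule_format] by (rule finite_rate_chain.intro)
  interpret C: finite_rate_chain C P q
    using C closed by (rule S.closed_class_chain)
  have range: "X t \<omega> \<in> S" if "0 \<le> t" "\<omega> \<in> space M" for t \<omega>
    using measurable_space[OF meas] that by fastforce
  have ev: "{\<omega> \<in> space M. X t \<omega> = i} \<in> events" if "0 \<le> t" "i \<in> S" for t i
  proof -
    have "{\<omega> \<in> space M. X t \<omega> = i} = X t -` {i} \<inter> space M" by auto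
    then show ?thesis using measurable_sets[OF meas, of t "{i}"] that by simp
  qed
  have ev2: "{\<omega> \<in> space M. X 0 \<omega> = i \<and> X t \<omega> = j} \<in> events"
    if "0 \<le> t" "i \<in> S" "j \<in> S" for t i j
    using ev[of 0 i] ev[of t j] that by (auto intro: sets.sets_Collect_conj)
  define m where "m i = \<P>(\<omega> in M. X 0 \<omega> = i)" for i
  have joint: "\<P>(\<omega> in M. X 0 \<omega> = i \<and> X t \<omega> = j) = m i * P t i j"
    if "0 \<le> t" "i \<in> S" "j \<in> S" for t i j
  proof (cases "m i = 0")
    case True
    have "\<P>(\<omega> in M. X 0 \<omega> = i \<and> X t \<omega> = j) \<le> m i"
      unfolding m_def using ev that by (intro finite_measure_mono) auto
    then show ?thesis using True by (simp add: measure_le_0_iff)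
  next
    case False
    then have "m i > 0" by (simp add: m_def zero_less_measure_iff)
    then show ?thesis
      using markov[rule_format, of "{}" 0 t j "\<lambda>_. i"] that
      by (simp add: m_def cond_prob_def conj_commute field_simps)
  qed
  have start_sum: "\<P>(\<omega> in M. X 0 \<omega> \<in> C) = (\<Sum>i\<in>C. m i)"
  proof -
    have "{\<omega> \<in> space M. X 0 \<omega> \<in> C} = (\<Union>i\<in>C. {\<omega> \<in> space M. X 0 \<omega> = i})" by auto
    then show ?thesis
      unfolding m_def using C.finite_S C
      by (simp, intro finite_measure_finite_Union) (auto simp: disjoint_family_on_def intro: ev)
  qed
  have joint_sum: "\<P>(\<omega> in M. X t \<omega> \<in> B \<and> X 0 \<omega> \<in> C) = (\<Sum>i\<in>C. m i * (\<Sum>j\<in>B \<inter> C. P t i j))"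
    if t: "0 \<le> t" for t
  proof -
    have ev3: "{\<omega> \<in> space M. X 0 \<omega> = i \<and> X t \<omega> = j} \<in> events"
      if "i \<in> C" "j \<in> S" for i j
      using ev2[OF t] that C by auto
    have "{\<omega> \<in> space M. X t \<omega> \<in> B \<and> X 0 \<omega> \<in> C}
        = (\<Union>(i, j)\<in>C \<times> (B \<inter> S). {\<omega> \<in> space M. X 0 \<omega> = i \<and> X t \<omega> = j})"
      using range[OF t] by auto
    then have "\<P>(\<omega> in M. X t \<omega> \<in> B \<and> X 0 \<omega> \<in> C)
        = (\<Sum>(i, j)\<in>C \<times> (B \<inter> S). \<P>(\<omega> in M. X 0 \<omega> = i \<and> X t \<omega> = j))"
      using C.finite_S S.finite_S C t
      by (simp add: split_def, intro finite_measure_finite_Union)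
         (auto simp: disjoint_family_on_def ev3)
    also have "\<dots> = (\<Sum>(i, j)\<in>C \<times> (B \<inter> S). m i * P t i j)"
      using C t by (intro sum.cong) (auto simp: joint)
    also have "\<dots> = (\<Sum>i\<in>C. m i * (\<Sum>j\<in>B \<inter> S. P t i j))"
      by (simp add: sum_distrib_left sum.cartesian_product)
    also have "\<dots> = (\<Sum>i\<in>C. m i * (\<Sum>j\<in>B \<inter> C. P t i j))"
      using C S.finite_S S.P_outside_closed_class[OF C closed _ _ t]
      by (intro sum.cong refl arg_cong2[where f = "(*)"] sum.mono_neutral_right) auto
    finally show ?thesis .
  qed
  have "((\<lambda>t. (\<Sum>i\<in>C. m i * (\<Sum>j\<in>B \<inter> C. P t i j)) / (\<Sum>i\<in>C. m i))
      \<longlongrightarrow> (\<Sum>i\<in>C. m i * (\<Sum>j\<in>B \<inter> C. w j)) / (\<Sum>i\<in>C. m i)) at_top"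
    using start start_sum
    by (intro tendsto_intros C.convergence_to_reversible_distribution irreducible bal sum_w) auto
  moreover have "(\<Sum>i\<in>C. m i * (\<Sum>j\<in>B \<inter> C. w j)) / (\<Sum>i\<in>C. m i) = (\<Sum>j\<in>B \<inter> C. w j)"
    using start start_sum by (simp flip: sum_distrib_right)
  moreover have "\<forall>\<^sub>F t in at_top. \<P>(\<omega> in M. X t \<omega> \<in> B \<bar> X 0 \<omega> \<in> C)
      = (\<Sum>i\<in>C. m i * (\<Sum>j\<in>B \<inter> C. P t i j)) / (\<Sum>i\<in>C. m i)"
    using eventually_ge_at_top[of 0]
    by eventually_elim (simp add: cond_prob_def joint_sum start_sum)
  ultimately show ?thesis by (simp add: tendsto_cong)
qed


section \<open>The exclusion process\<close>

lemma swap_states_move: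
  assumes "x \<in> \<eta>" "y \<notin> \<eta>"
  shows "swap_states x y \<eta> = insert y (\<eta> - {x})"
proof (rule set_eqI)
  fix z
  have "x \<noteq> y" using assms by auto
  then show "z \<in> swap_states x y \<eta> \<longleftrightarrow> z \<in> insert y (\<eta> - {x})"
    using assms by (cases "z = x"; cases "z = y") (simp_all add: swap_states_def)
qed

lemma deg_pos_if_arc:
  assumes "graph G" "(x, y) \<in> arcs_ends G"
  shows "deg G x > 0"
proof -
  interpret graph G by fact
  obtain e where "e \<in> arcs G" "tail G e = x" using assms by (auto simp: arcs_ends_conv)
  then have "e \<in> out_arcs G x" by (simp add: out_arcs_def)
  moreover have "finite (out_arcs G x)" by (simp add: out_arcs_def)
  ultimately show ?thesis by (auto simp: out_degree_def card_gt_0_iff)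
qed

lemma exclusion_rate_pos:
  assumes "graph G" and \<rho>: "\<And>z. z \<in> verts G \<Longrightarrow> \<rho> z > 0"
    and arc: "(x, y) \<in> arcs_ends G" and occ: "x \<in> \<eta>" "y \<notin> \<eta>"
  shows "exclusion_rate G \<rho> \<eta> (insert y (\<eta> - {x})) > 0"
proof -
  interpret graph G by fact
  show ?thesis
    unfolding exclusion_rate_def
  proof (rule sum_pos2)
    show "finite {(x', y'). (x', y') \<in> arcs_ends G \<and> x' \<in> \<eta> \<and> y' \<notin> \<eta> \<and>
        insert y (\<eta> - {x}) = swap_states x' y' \<eta>}"
      by (rule finite_subset[of _ "arcs_ends G"]) (auto simp: arcs_ends_conv)
    show "(x, y) \<in> {(x', y'). (x', y') \<in> arcs_ends G \<and> x' \<in> \<eta> \<and> y' \<notin> \<eta> \<and>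
        insert y (\<eta> - {x}) = swap_states x' y' \<eta>}"
      using arc occ by (simp add: swap_states_move)
    show "0 < (case (x, y) of (x, y) \<Rightarrow> \<rho> x / real (deg G x))"
      using arc \<rho> deg_pos_if_arc[OF assms(1) arc] by (auto dest: adj_in_verts)
    show "0 \<le> (case e of (x, y) \<Rightarrow> \<rho> x / real (deg G x))"
      if "e \<in> {(x', y'). (x', y') \<in> arcs_ends G \<and> x' \<in> \<eta> \<and> y' \<notin> \<eta> \<and>
        insert y (\<eta> - {x}) = swap_states x' y' \<eta>}" for e
      using that by (auto dest!: adj_in_verts(1) \<rho>)
  qed
qed

lemma exclusion_rate_card_neq:
  assumes "finite \<eta>" "card \<eta> \<noteq> card \<xi>"
  shows "exclusion_rate G \<rho> \<eta> \<xi> = 0"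
proof -
  have "card (swap_states x y \<eta>) = card \<eta>" if "x \<in> \<eta>" "y \<notin> \<eta>" for x y
  proof -
    have "card \<eta> > 0" using that assms(1) by (auto simp: card_gt_0_iff)
    then show ?thesis using that assms(1) by (simp add: swap_states_move)
  qed
  then have "{(x, y). (x, y) \<in> arcs_ends G \<and> x \<in> \<eta> \<and> y \<notin> \<eta> \<and> \<xi> = swap_states x y \<eta>} = {}"
    using assms(2) by fastforce
  then show ?thesis unfolding exclusion_rate_def by (simp only: sum.empty)
qed

text \<open>
  A jump from \<open>x\<close> to \<open>y\<close> is undone by one from \<open>y\<close> to \<open>x\<close>. For two configurations that are one jump
  apart, both sides equal the weight of their common part: the weight \<open>D x\<close> of the particle is the inverse of the rate at which it
  leaves \<open>x\<close> along any given edge.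
\<close>

lemma exclusion_detailed_balance:
  assumes "graph G" and \<rho>: "\<And>z. z \<in> verts G \<Longrightarrow> \<rho> z > 0"
    and fin: "finite \<eta>" "finite \<xi>"
  defines "D \<equiv> \<lambda>z. real (deg G z) / \<rho> z"
  shows "prod D \<eta> * exclusion_rate G \<rho> \<eta> \<xi> = prod D \<xi> * exclusion_rate G \<rho> \<xi> \<eta>"
proof -
  interpret graph G by fact
  have "(\<Sum>(x, y) | (x, y) \<in> arcs_ends G \<and> x \<in> \<eta> \<and> y \<notin> \<eta> \<and> \<xi> = swap_states x y \<eta>.
        prod D \<eta> * (\<rho> x / real (deg G x)))
    = (\<Sum>(x, y) | (x, y) \<in> arcs_ends G \<and> x \<in> \<xi> \<and> y \<notin> \<xi> \<and> \<eta> = swap_states x y \<xi>.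
        prod D \<xi> * (\<rho> x / real (deg G x)))"
  proof (rule sum.reindex_bij_witness[of _ prod.swap prod.swap])
    have move: "swap_states x y \<eta> = insert y (\<eta> - {x})
        \<and> (y, x) \<in> arcs_ends G \<and> y \<in> swap_states x y \<eta> \<and> x \<notin> swap_states x y \<eta>
        \<and> \<eta> = swap_states y x (swap_states x y \<eta>)"
      if "(x, y) \<in> arcs_ends G" "x \<in> \<eta>" "y \<notin> \<eta>" for x y and \<eta> :: "'a set"
    proof -
      have "x \<noteq> y" using that by auto
      then have "swap_states y x (insert y (\<eta> - {x})) = insert x (insert y (\<eta> - {x}) - {y})"
        by (intro swap_states_move) auto
      also have "\<dots> = \<eta>" using that by auto
      finally show ?thesis
        unfolding swap_states_move[OF that(2,3)]
        using that \<open>x \<noteq> y\<close> arcs_ends_symmetric[OF sym_arcs that(1)] by auto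
    qed
    fix e assume "e \<in> {(x, y). (x, y) \<in> arcs_ends G \<and> x \<in> \<eta> \<and> y \<notin> \<eta> \<and> \<xi> = swap_states x y \<eta>}"
    then obtain x y where e: "e = (x, y)" and arc: "(x, y) \<in> arcs_ends G"
      and occ: "x \<in> \<eta>" "y \<notin> \<eta>" and \<xi>: "\<xi> = swap_states x y \<eta>" by auto
    have arc': "(y, x) \<in> arcs_ends G" and occ': "y \<in> \<xi>" "x \<notin> \<xi>" "\<eta> = swap_states y x \<xi>"
      using move[OF arc occ] unfolding \<xi> by blast+
    then show "prod.swap e \<in> {(x, y). (x, y) \<in> arcs_ends G \<and> x \<in> \<xi> \<and> y \<notin> \<xi> \<and> \<eta> = swap_states x y \<xi>}"
      by (simp add: e)
    have "\<rho> x > 0" "\<rho> y > 0" "deg G x > 0" "deg G y > 0"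
      using arc arc' deg_pos_if_arc[OF assms(1)] \<rho> by (auto dest: adj_in_verts)
    moreover have "prod D \<eta> = D x * prod D (\<eta> - {x})"
      using fin occ by (intro prod.remove) auto
    moreover have "prod D \<xi> = D y * prod D (\<eta> - {x})"
      using move[OF arc occ] fin occ by (simp add: \<xi>)
    ultimately show "(case prod.swap e of (x, y) \<Rightarrow> prod D \<xi> * (\<rho> x / real (deg G x)))
        = (case e of (x, y) \<Rightarrow> prod D \<eta> * (\<rho> x / real (deg G x)))"
      by (simp add: e D_def)
    show "prod.swap (prod.swap e) = e" by simp
  next
    fix e assume "e \<in> {(x, y). (x, y) \<in> arcs_ends G \<and> x \<in> \<xi> \<and> y \<notin> \<xi> \<and> \<eta> = swap_states x y \<xi>}"
    then obtain x y where e: "e = (x, y)" and arc: "(x, y) \<in> arcs_ends G"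
      and occ: "x \<in> \<xi>" "y \<notin> \<xi>" and \<eta>: "\<eta> = swap_states x y \<xi>" by auto
    have "x \<noteq> y" using occ by auto
    have "\<xi> = swap_states y x \<eta> \<and> y \<in> \<eta> \<and> x \<notin> \<eta>"
    proof -
      have s: "\<eta> = insert y (\<xi> - {x})" using occ by (simp add: \<eta> swap_states_move)
      then have "swap_states y x \<eta> = insert x (\<eta> - {y})"
        using \<open>x \<noteq> y\<close> by (intro swap_states_move) auto
      then show ?thesis using s occ by auto
    qed
    then show "prod.swap e \<in> {(x, y). (x, y) \<in> arcs_ends G \<and> x \<in> \<eta> \<and> y \<notin> \<eta> \<and> \<xi> = swap_states x y \<eta>}"
      using arc arcs_ends_symmetric[OF sym_arcs] by (auto simp: e)
    show "prod.swap (prod.swap e) = e" by simp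
  qed
  then show ?thesis
    by (simp add: exclusion_rate_def sum_distrib_left split_def)
qed

lemma connected_graph_arc_path:
  assumes "graph G" "Digraph_Component.connected G" "x \<in> verts G" "y \<in> verts G"
  shows "(x, y) \<in> (arcs_ends G)\<^sup>*"
proof -
  interpret graph G by fact
  have "strongly_connected G"
    using sym_arcs assms(2) by (rule symmetric_connected_imp_strongly_connected)
  then have "x \<rightarrow>\<^sup>*\<^bsub>G\<^esub> y" using assms by auto
  then show ?thesis by (auto simp: reachable_def intro: rtrancl_on_rtranclI)
qed

lemma connected_graph_deg_pos:
  assumes "graph G" "Digraph_Component.connected G" "1 < card (verts G)" "x \<in> verts G"
  shows "deg G x > 0"
proof -
  have "card (verts G - {x}) > 0" using assms by (simp add: card_Diff_singleton)
  then obtain y where "y \<in> verts G" "y \<noteq> x" by (auto simp: card_gt_0_iff)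
  then have "(x, y) \<in> (arcs_ends G)\<^sup>*" using assms by (intro connected_graph_arc_path)
  with \<open>y \<noteq> x\<close> obtain z where "(x, z) \<in> arcs_ends G" by (auto elim: converse_rtranclE)
  then show ?thesis using assms(1) by (intro deg_pos_if_arc)
qed

definition configurations :: "('v, 'e) pre_digraph \<Rightarrow> nat \<Rightarrow> 'v set set" where
  "configurations G k = {\<eta>. \<eta> \<subseteq> verts G \<and> card \<eta> = k}"

definition exclusion_moves ::
    "('v, 'e) pre_digraph \<Rightarrow> ('v \<Rightarrow> real) \<Rightarrow> nat \<Rightarrow> ('v set \<times> 'v set) set" where
  "exclusion_moves G \<rho> k = {(\<eta>, \<xi>). \<eta> \<in> configurations G k \<and> \<xi> \<in> configurations G k
     \<and> \<eta> \<noteq> \<xi> \<and> exclusion_rate G \<rho> \<eta> \<xi> > 0}"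

text \<open>
  Particles are indistinguishable, so an occupied vertex on the path is no obstacle: the particle there is
  the one that is moved to \<open>y\<close> first, and the one at \<open>x\<close> takes its place afterwards. The induction
  therefore ranges over all configurations, and it tolerates paths that visit a vertex repeatedly.
\<close>

lemma move_particle_along_path:
  assumes "graph G" and \<rho>: "\<And>z. z \<in> verts G \<Longrightarrow> \<rho> z > 0"
    and path: "(x, y) \<in> (arcs_ends G)\<^sup>*"
    and \<eta>: "\<eta> \<in> configurations G k" "x \<in> \<eta>" "y \<notin> \<eta>"
  shows "(\<eta>, insert y (\<eta> - {x})) \<in> (exclusion_moves G \<rho> k)\<^sup>*
    \<and> insert y (\<eta> - {x}) \<in> configurations G k"
  using path \<eta>
proof (induction arbitrary: \<eta> rule: converse_rtrancl_induct)
  case base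
  then show ?case by simp
next
  case (step x z)
  interpret graph G by fact
  have jump: "(\<zeta>, insert z (\<zeta> - {x})) \<in> exclusion_moves G \<rho> k"
    if "\<zeta> \<in> configurations G k" "x \<in> \<zeta>" "z \<notin> \<zeta>" for \<zeta>
  proof -
    have fin: "finite \<zeta>"
      using that by (auto simp: configurations_def dest: finite_subset[OF _ finite_verts])
    then have c: "card \<zeta> > 0" using that by (auto simp: card_gt_0_iff)
    have "z \<in> verts G" using step.hyps(1) by (auto dest: adj_in_verts)
    then have "insert z (\<zeta> - {x}) \<in> configurations G k"
      using that fin c by (auto simp: configurations_def)
    then show ?thesis
      using that exclusion_rate_pos[OF assms(1) \<rho> step.hyps(1)]
      by (auto simp: exclusion_moves_def)
  qed
  have conf: "\<xi> \<in> configurations G k" if "(\<zeta>, \<xi>) \<in> exclusion_moves G \<rho> k" for \<zeta> \<xi>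
    using that by (simp add: exclusion_moves_def)
  show ?case
  proof (cases "z \<in> \<eta>")
    case False
    let ?\<eta>' = "insert z (\<eta> - {x})"
    have first: "(\<eta>, ?\<eta>') \<in> exclusion_moves G \<rho> k" using jump step.prems False by simp
    show ?thesis
    proof (cases "z = y")
      case False
      have "x \<noteq> y" using step.prems by auto
      moreover have "insert y (?\<eta>' - {z}) = insert y (\<eta> - {x})" using \<open>z \<notin> \<eta>\<close> by auto
      ultimately show ?thesis
        using step.IH[of ?\<eta>'] first conf[OF first] False step.prems
        by (auto intro: converse_rtrancl_into_rtrancl)
    qed (use first conf[OF first] in auto)
  next
    case True
    let ?\<eta>' = "insert y (\<eta> - {z})"
    have far: "(\<eta>, ?\<eta>') \<in> (exclusion_moves G \<rho> k)\<^sup>*" "?\<eta>' \<in> configurations G k"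
      using step.IH step.prems True by auto
    show ?thesis
    proof (cases "x = z")
      case False
      have "z \<noteq> y" "x \<noteq> y" using True step.prems by auto
      then have near: "(?\<eta>', insert z (?\<eta>' - {x})) \<in> exclusion_moves G \<rho> k"
        using jump far(2) step.prems False by simp
      have "insert z (?\<eta>' - {x}) = insert y (\<eta> - {x})"
        using True False \<open>x \<noteq> y\<close> by auto
      then show ?thesis using far near conf[OF near] by (auto intro: rtrancl_into_rtrancl)
    qed (use far in auto)
  qed
qed

text \<open>
  Moving a particle from a vertex outside \<open>\<xi>\<close> to an empty one inside \<open>\<xi>\<close> decreases the number of misplaced
  particles.
\<close>

lemma exclusion_irreducible:
  assumes "graph G" "Digraph_Component.connected G" and \<rho>: "\<And>z. z \<in> verts G \<Longrightarrow> \<rho> z > 0"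
    and "\<eta> \<in> configurations G k" and \<xi>: "\<xi> \<in> configurations G k"
  shows "(\<eta>, \<xi>) \<in> (exclusion_moves G \<rho> k)\<^sup>*"
  using assms(4)
proof (induction "card (\<eta> - \<xi>)" arbitrary: \<eta> rule: less_induct)
  case less
  interpret graph G by fact
  have fin: "finite \<eta>" "finite \<xi>" and card: "card \<eta> = card \<xi>"
    using less.prems \<xi> by (auto simp: configurations_def intro: finite_subset)
  show ?case
  proof (cases "\<eta> = \<xi>")
    case False
    then obtain x y where x: "x \<in> \<eta>" "x \<notin> \<xi>" and y: "y \<in> \<xi>" "y \<notin> \<eta>"
      using fin card card_subset_eq[of \<xi> \<eta>] card_subset_eq[of \<eta> \<xi>] by fastforce
    have "x \<in> verts G" "y \<in> verts G" using x y less.prems \<xi> by (auto simp: configurations_def)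
    then have path: "(x, y) \<in> (arcs_ends G)\<^sup>*"
      using assms(1,2) by (intro connected_graph_arc_path)
    let ?\<eta>' = "insert y (\<eta> - {x})"
    have move: "(\<eta>, ?\<eta>') \<in> (exclusion_moves G \<rho> k)\<^sup>*" "?\<eta>' \<in> configurations G k"
      using move_particle_along_path[OF assms(1) \<rho> path less.prems x(1) y(2)] by auto
    have "?\<eta>' - \<xi> = (\<eta> - \<xi>) - {x}" using y by auto
    then have "card (?\<eta>' - \<xi>) < card (\<eta> - \<xi>)"
      using x fin by (intro psubset_card_mono) auto
    then have "(?\<eta>', \<xi>) \<in> (exclusion_moves G \<rho> k)\<^sup>*" using less.hyps move(2) by blast
    then show ?thesis using move(1) by (rule rtrancl_trans[rotated])
  qed simp
qed

text \<open>
  The configurations with \<open>k\<close> particles form a closed irreducible class whose reversible distribution has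
  weights proportional to \<open>prod D \<xi>\<close>. With a single vertex \<open>D\<close> would vanish; two
  vertices and connectedness make it positive.
\<close>

lemma limit_occupation_exclusion:
  assumes G: "graph G" "Digraph_Component.connected G" and card: "1 < card (verts G)" "k \<le> card (verts G)"
    and \<rho>: "\<And>z. z \<in> verts G \<Longrightarrow> \<rho> z > 0"
    and process: "exclusion_process G \<rho> M \<eta>"
    and start: "\<P>(\<omega> in M. card (\<eta> 0 \<omega>) = k) > 0"
  defines "D \<equiv> \<lambda>z. real (deg G z) / \<rho> z"
  shows "limit_occupation M \<eta> k x
    = (\<Sum>\<xi> | \<xi> \<subseteq> verts G \<and> card \<xi> = k \<and> x \<in> \<xi>. prod D \<xi>) / elem_sym D (verts G) k"
proof -
  interpret graph G by fact
  let ?C = "configurations G k"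
  have fin: "finite \<xi>" if "\<xi> \<subseteq> verts G" for \<xi>
    using that by (rule finite_subset) simp
  have "D z > 0" if "z \<in> verts G" for z
    using connected_graph_deg_pos[OF G card(1) that] \<rho>[OF that] by (simp add: D_def)
  then have e: "elem_sym D (verts G) k > 0" using card by (intro elem_sym_pos) auto
  have chain: "markov_chain_with_rates M (Pow (verts G)) (exclusion_rate G \<rho>) \<eta>"
    using process by (simp add: exclusion_process_def)
  then have meas: "\<And>t. 0 \<le> t \<Longrightarrow> \<eta> t \<in> measurable M (count_space (Pow (verts G)))"
    by (simp add: markov_chain_with_rates_def)
  have range: "\<eta> 0 \<omega> \<subseteq> verts G" if "\<omega> \<in> space M" for \<omega>
    using measurable_space[OF meas, of 0 \<omega>] that by simp
  have conf0: "\<eta> 0 \<omega> \<in> ?C \<longleftrightarrow> card (\<eta> 0 \<omega>) = k" if "\<omega> \<in> space M" for \<omega>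
    using range[OF that] by (simp add: configurations_def)
  have "((\<lambda>t. \<P>(\<omega> in M. \<eta> t \<omega> \<in> {\<xi>. x \<in> \<xi>} \<bar> \<eta> 0 \<omega> \<in> ?C))
      \<longlongrightarrow> (\<Sum>\<xi>\<in>{\<xi>. x \<in> \<xi>} \<inter> ?C. prod D \<xi> / elem_sym D (verts G) k)) at_top"
  proof (rule markov_chain_conditional_limit[OF chain])
    show "exclusion_rate G \<rho> \<eta> \<xi> = 0"
      if "\<eta> \<in> Pow (verts G)" "\<xi> \<in> Pow (verts G)" "(\<eta> \<in> ?C) \<noteq> (\<xi> \<in> ?C)" for \<eta> \<xi>
      using that fin by (intro exclusion_rate_card_neq) (auto simp: configurations_def)
    show "(\<eta>, \<xi>) \<in> {(\<eta>, \<xi>). \<eta> \<in> ?C \<and> \<xi> \<in> ?C \<and> \<eta> \<noteq> \<xi> \<and> exclusion_rate G \<rho> \<eta> \<xi> > 0}\<^sup>*"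
      if "\<eta> \<in> ?C" "\<xi> \<in> ?C" for \<eta> \<xi>
      using exclusion_irreducible[OF G \<rho> that] by (simp add: exclusion_moves_def)
    show "prod D \<eta> / elem_sym D (verts G) k * exclusion_rate G \<rho> \<eta> \<xi>
        = prod D \<xi> / elem_sym D (verts G) k * exclusion_rate G \<rho> \<xi> \<eta>"
      if "\<eta> \<in> ?C" "\<xi> \<in> ?C" for \<eta> \<xi>
      using exclusion_detailed_balance[OF G(1) \<rho>, where \<eta> = \<eta> and \<xi> = \<xi>] that fin
      by (simp add: D_def configurations_def)
    show "(\<Sum>\<xi>\<in>?C. prod D \<xi> / elem_sym D (verts G) k) = 1"
      using e by (simp add: configurations_def elem_sym_def flip: sum_divide_distrib)
    have "{\<omega> \<in> space M. \<eta> 0 \<omega> \<in> ?C} = {\<omega> \<in> space M. card (\<eta> 0 \<omega>) = k}"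
      using conf0 by auto
    then show "\<P>(\<omega> in M. \<eta> 0 \<omega> \<in> ?C) > 0" using start by simp
  qed (auto simp: configurations_def)
  moreover have "\<P>(\<omega> in M. \<eta> t \<omega> \<in> {\<xi>. x \<in> \<xi>} \<bar> \<eta> 0 \<omega> \<in> ?C)
      = \<P>(\<omega> in M. x \<in> \<eta> t \<omega> \<bar> card (\<eta> 0 \<omega>) = k)" for t
    unfolding cond_prob_def using conf0
    by (intro arg_cong2[where f = "(/)"] arg_cong[where f = "measure M"]) auto
  ultimately have "limit_occupation M \<eta> k x
      = (\<Sum>\<xi>\<in>{\<xi>. x \<in> \<xi>} \<inter> ?C. prod D \<xi> / elem_sym D (verts G) k)"
    unfolding limit_occupation_def by (intro tendsto_Lim) auto
  also have "{\<xi>. x \<in> \<xi>} \<inter> ?C = {\<xi>. \<xi> \<subseteq> verts G \<and> card \<xi> = k \<and> x \<in> \<xi>}"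
    by (auto simp: configurations_def)
  finally show ?thesis by (simp add: sum_divide_distrib)
qed


section \<open>Ratios of occupation probabilities\<close>

text \<open>
  Both sums are split by the states of \<open>x\<close> and \<open>y\<close>. The configurations that occupy both contribute the same
  term to each of them, and the ones that occupy exactly one of the two differ only by the factors \<open>D x\<close> and
  \<open>D y\<close>.
\<close>

lemma occupation_ratio_elem_sym:
  fixes D :: "'a \<Rightarrow> real"
  assumes A: "finite A" and x: "x \<in> A" and y: "y \<in> A" and ne: "x \<noteq> y"
  defines "E \<equiv> elem_sym D (A - {x, y})"
    and "S \<equiv> \<lambda>k z. \<Sum>B | B \<subseteq> A \<and> card B = k \<and> z \<in> B. prod D B"
  shows "S 1 x / S 1 y = D x / D y"
    and "S (m + 2) x / S (m + 2) y
      = (D x * E (m + 1) + D x * D y * E m) / (D y * E (m + 1) + D x * D y * E m)"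
proof -
  have ins: "insert z (A - {z}) = A" if "z \<in> A" for z using that by auto
  have S: "S (Suc k) z = D z * elem_sym D (A - {z}) k" if "z \<in> A" for k z
    using sum_prod_subsets_containing[of "A - {z}" z D k] A ins[OF that] by (simp add: S_def)
  show "S 1 x / S 1 y = D x / D y"
    using S[OF x, of 0] S[OF y, of 0] A by simp
  have Ax: "A - {x} = insert y (A - {x, y})" and Ay: "A - {y} = insert x (A - {x, y})"
    using x y ne by auto
  have "elem_sym D (A - {x}) (Suc m) = E (Suc m) + D y * E m"
    unfolding Ax E_def using A by (intro elem_sym_insert) auto
  moreover have "elem_sym D (A - {y}) (Suc m) = E (Suc m) + D x * E m"
    unfolding Ay E_def using A by (intro elem_sym_insert) auto
  ultimately show "S (m + 2) x / S (m + 2) y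
      = (D x * E (m + 1) + D x * D y * E m) / (D y * E (m + 1) + D x * D y * E m)"
    using S[OF x, of "Suc m"] S[OF y, of "Suc m"] by (simp add: algebra_simps)
qed

theorem theorem2:
  fixes G :: "('v, 'e) pre_digraph"
    and \<rho> :: "'v \<Rightarrow> real"
    and M :: "nat \<Rightarrow> 'w measure"
    and \<eta> :: "nat \<Rightarrow> real \<Rightarrow> 'w \<Rightarrow> 'v set"
    and N K :: nat
    and x y :: 'v
  defines "D \<equiv> \<lambda>z. real (deg G z) / \<rho> z"
    and "p \<equiv> \<lambda>k z. limit_occupation (M k) (\<eta> k) k z"
  assumes "graph G" and "Digraph_Component.connected G"
    and "card (verts G) = N"
    and "\<And>z. z \<in> verts G \<Longrightarrow> \<rho> z > 0"
    and "\<And>k. 0 < k \<Longrightarrow> k \<le> N \<Longrightarrow> exclusion_process G \<rho> (M k) (\<eta> k)"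
    and "\<And>k. 0 < k \<Longrightarrow> k \<le> N \<Longrightarrow> \<P>(\<omega> in M k. card (\<eta> k 0 \<omega>) = k) > 0"
    and "1 < K" and "K < N - 1"
    and "x \<in> verts G" and "y \<in> verts G" and "D x < D y"
  shows "D x / D y = p 1 x / p 1 y
    \<and> p 1 x / p 1 y < p K x / p K y
    \<and> p K x / p K y < p (K + 1) x / p (K + 1) y
    \<and> p (K + 1) x / p (K + 1) y < p N x / p N y
    \<and> p N x / p N y = 1"
proof -
  interpret graph G by fact
  note \<rho> = \<open>\<And>z. z \<in> verts G \<Longrightarrow> \<rho> z > 0\<close>
  have N: "1 < card (verts G)" using \<open>1 < K\<close> \<open>K < N - 1\<close> \<open>card (verts G) = N\<close> by simp
  have D_pos: "D z > 0" if "z \<in> verts G" for z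
    using connected_graph_deg_pos[OF assms(3,4) N that] \<rho>[OF that] by (simp add: D_def)
  define a b where "a = D x" and "b = D y"
  have ab: "0 < a" "a < b" "0 < b"
    using D_pos \<open>x \<in> verts G\<close> \<open>y \<in> verts G\<close> \<open>D x < D y\<close> by (auto simp: a_def b_def)
  have ne: "x \<noteq> y" using \<open>D x < D y\<close> by auto
  define S where "S k z = (\<Sum>\<xi> | \<xi> \<subseteq> verts G \<and> card \<xi> = k \<and> z \<in> \<xi>. prod D \<xi>)" for k z
  define E where "E = elem_sym D (verts G - {x, y})"
  have p: "p k x / p k y = S k x / S k y" if k: "0 < k" "k \<le> N" for k
  proof -
    have "elem_sym D (verts G) k > 0"
      using D_pos k \<open>card (verts G) = N\<close> by (intro elem_sym_pos) auto
    moreover have "p k z = S k z / elem_sym D (verts G) k" for z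
      unfolding p_def S_def D_def
      using k assms(3-8) N by (intro limit_occupation_exclusion) auto
    ultimately show ?thesis by simp
  qed
  note sums = \<open>x \<in> verts G\<close> \<open>y \<in> verts G\<close> ne
  have ratio1: "p 1 x / p 1 y = a / b"
    using occupation_ratio_elem_sym(1)[OF finite_verts sums, where D = D] p[of 1] N
      \<open>card (verts G) = N\<close>
    by (simp add: S_def a_def b_def)
  have ratio: "p (m + 2) x / p (m + 2) y
      = (a * E (m + 1) + a * b * E m) / (b * E (m + 1) + a * b * E m)" if "m + 2 \<le> N" for m
    using occupation_ratio_elem_sym(2)[OF finite_verts sums, where D = D and m = m]
      p[of "m + 2"] that
    by (simp add: S_def E_def a_def b_def)
  have cardW: "card (verts G - {x, y}) = N - 2"
    using \<open>card (verts G) = N\<close> \<open>x \<in> verts G\<close> \<open>y \<in> verts G\<close> ne by (simp add: card_Diff_subset)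
  have E_pos: "E k > 0" if "k \<le> N - 2" for k
    unfolding E_def using that cardW D_pos by (intro elem_sym_pos) auto
  \<comment> \<open>With \<open>m + 2\<close> particles, the configurations that occupy both \<open>x\<close> and \<open>y\<close> have weight \<open>a * b * E m\<close>, and
    the ones that occupy only \<open>x\<close> or only \<open>y\<close> have weight \<open>a * E (m + 1)\<close> or \<open>b * E (m + 1)\<close>. Joint occupation
    gains in relative weight as \<open>m\<close> grows, by log-concavity.\<close>
  define r where "r k = E k / E (k + 1)" for k
  have r_pos: "r k > 0" if "k + 1 \<le> N - 2" for k
    using that E_pos by (simp add: r_def)
  have ratio_r: "p (m + 2) x / p (m + 2) y = (a + a * b * r m) / (b + a * b * r m)"
    if m: "m + 1 \<le> N - 2" for m
  proof -
    have e: "E (m + 1) > 0" using m by (rule E_pos)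
    have "(a * E (m + 1) + a * b * E m) / (b * E (m + 1) + a * b * E m)
        = (E (m + 1) * (a + a * b * r m)) / (E (m + 1) * (b + a * b * r m))"
      using e by (simp add: r_def algebra_simps)
    then show ?thesis using ratio[of m] m e by simp
  qed
  obtain m where m: "K = m + 2" using \<open>1 < K\<close> that[of "K - 2"] by simp
  have mN: "m + 2 \<le> N - 2" using m \<open>K < N - 1\<close> by simp
  have r_less: "r m < r (m + 1)"
  proof -
    have "E m * E (m + 2) < (E (m + 1))\<^sup>2"
      unfolding E_def using mN cardW D_pos by (intro elem_sym_strict_log_concave) auto
    then show ?thesis
      using E_pos[of "m + 1"] E_pos[of "m + 2"] mN
      by (simp add: r_def divide_simps power2_eq_square mult.commute)
  qed
  have ratio_K: "p K x / p K y = (a + a * b * r m) / (b + a * b * r m)"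
    using ratio_r[of m] mN m by simp
  have ratio_K1: "p (K + 1) x / p (K + 1) y = (a + a * b * r (m + 1)) / (b + a * b * r (m + 1))"
    using ratio_r[of "m + 1"] mN m by simp
  have ratio_N: "p N x / p N y = 1"
  proof -
    have "E (N - 2 + 1) = 0" unfolding E_def using cardW by (intro elem_sym_eq_0) auto
    moreover have "E (N - 2) > 0" by (rule E_pos) simp
    moreover have "N - 2 + 2 = N" using N \<open>card (verts G) = N\<close> by simp
    moreover note ratio[of "N - 2"]
    ultimately show ?thesis using ab by simp
  qed
  have "p 1 x / p 1 y < p K x / p K y"
    unfolding ratio1 ratio_K
    using occupation_ratio_less[OF ab(1,2) _ r_pos[of m]] mN by simp
  moreover have "p K x / p K y < p (K + 1) x / p (K + 1) y"
    unfolding ratio_K ratio_K1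
    using r_pos[of m] mN by (intro occupation_ratio_less ab r_less) auto
  moreover have "p (K + 1) x / p (K + 1) y < 1"
    unfolding ratio_K1
    using ab r_pos[of "m + 1"] mN by (subst divide_less_eq_1_pos) (auto intro!: add_pos_pos)
  ultimately show ?thesis
    using ratio1 ratio_N by (simp add: a_def b_def)
qed

end
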